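(* Let $q\ge 2$, let $D$ be a normalized difference matrix $\mathrm{ND}(rq,c,q)$ defined on an Abelian group $\mathcal{A}=\{0,\ldots,q-1\}$, without identical rows, and let $F$ be an $F(n,q^m)$ without fully aliased columns and with constant coincidence numbers, say $\lambda$, between its different rows. Then: (a) $F\oplus_{\mathcal{A}}D'$ is an $F(cn,q^{rqm})$ with two different values of coincidence numbers (between its different rows), $mr$ and $\lambda rq$; (b) $F\oplus_{\mathcal{A}}D'$ has no fully aliased columns.
   Context: Prime denotes transpose. An $F(n,q^m)$ is an $n\times m$ matrix (design with $n$ runs and $m$ factors) with entries in $\{0,\ldots,q-1\}$ that is balanced: in every column each of the $q$ symbols occurs equally often. Two columns are fully aliased if one can be obtained from the other by permuting the levels; a design has no fully aliased columns if no two columns in distinct positions are fully aliased. The coincidence number between rows $i$ and $j$ of a design is the number of columns in which rows $i$ and $j$ have the same entry. A difference matrix $D(rq,c,q)$ is an $rq\times c$ array with entries from a finite Abelian group $(\mathcal{A},+)$ with $q$ elements such that each element of $\mathcal{A}$ appears equally often in the vector of differences between any two distinct columns. A difference matrix with $c>1$ is normalized, written $\mathrm{ND}(rq,c,q)$, if its first column consists of all zeros, $0$ being the identity element of $\mathcal{A}$. For $A=(a_{ij})$ and a matrix $B$ with entries in $\mathcal{A}$, the Kronecker sum $A\oplus_{\mathcal{A}}B$ is the block matrix whose $(i,j)$ block is obtained by adding $a_{ij}$ to every entry of $B$, with addition in the group $\mathcal{A}$. *)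

theory Defs
  imports "HOL-Algebra.Ring" "HOL-Combinatorics.Permutations" "Jordan_Normal_Form.Matrix"
begin

text \<open>An $F(n,q^m)$, with levels \<open>0, \<dots>, q - 1\<close>.\<close>

definition balanced_design :: "nat \<Rightarrow> nat \<Rightarrow> nat \<Rightarrow> nat mat \<Rightarrow> bool" where
  "balanced_design n q m F \<longleftrightarrow>
     0 < n \<and> 0 < m \<and> F \<in> carrier_mat n m \<and>
     (\<forall>i<n. \<forall>j<m. F $$ (i, j) \<in> {0..<q}) \<and>
     (\<forall>j<m. \<forall>a\<in>{0..<q}. \<forall>b\<in>{0..<q}.
        card {i. i < n \<and> F $$ (i, j) = a} = card {i. i < n \<and> F $$ (i, j) = b})"

definition fully_aliased :: "nat \<Rightarrow> nat vec \<Rightarrow> nat vec \<Rightarrow> bool" where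
  "fully_aliased q u v \<longleftrightarrow> (\<exists>\<pi>. \<pi> permutes {0..<q} \<and> v = map_vec \<pi> u)"

definition no_fully_aliased_columns :: "nat \<Rightarrow> nat mat \<Rightarrow> bool" where
  "no_fully_aliased_columns q F \<longleftrightarrow>
     (\<forall>j<dim_col F. \<forall>k<dim_col F. j \<noteq> k \<longrightarrow> \<not> fully_aliased q (col F j) (col F k))"

definition coincidence_number :: "'a mat \<Rightarrow> nat \<Rightarrow> nat \<Rightarrow> nat" where
  "coincidence_number F i j = card {k. k < dim_col F \<and> F $$ (i, k) = F $$ (j, k)}"

definition coincidence_numbers :: "'a mat \<Rightarrow> nat set" where
  "coincidence_numbers F =
     {coincidence_number F i j | i j. i < dim_row F \<and> j < dim_row F \<and> i \<noteq> j}"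

text \<open>A $D(rq,c,q)$ over the additive group of \<open>A\<close>. The locale \<open>abelian_group\<close> constrains only
  the additive part of the ring record; its multiplicative fields play no role here.\<close>

definition difference_matrix ::
    "('a, 'b) ring_scheme \<Rightarrow> nat \<Rightarrow> nat \<Rightarrow> nat \<Rightarrow> 'a mat \<Rightarrow> bool" where
  "difference_matrix A r c q D \<longleftrightarrow>
     abelian_group A \<and> finite (carrier A) \<and> card (carrier A) = q \<and>
     0 < r \<and> 0 < c \<and> D \<in> carrier_mat (r * q) c \<and>
     (\<forall>i<r * q. \<forall>j<c. D $$ (i, j) \<in> carrier A) \<and>
     (\<forall>j<c. \<forall>k<c. j \<noteq> k \<longrightarrow> (\<forall>x\<in>carrier A. \<forall>y\<in>carrier A.
        card {i. i < r * q \<and> D $$ (i, j) \<ominus>\<^bsub>A\<^esub> D $$ (i, k) = x} =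
        card {i. i < r * q \<and> D $$ (i, j) \<ominus>\<^bsub>A\<^esub> D $$ (i, k) = y}))"

definition normalized_difference_matrix ::
    "('a, 'b) ring_scheme \<Rightarrow> nat \<Rightarrow> nat \<Rightarrow> nat \<Rightarrow> 'a mat \<Rightarrow> bool" where
  "normalized_difference_matrix A r c q D \<longleftrightarrow>
     difference_matrix A r c q D \<and> 1 < c \<and> (\<forall>i<r * q. D $$ (i, 0) = \<zero>\<^bsub>A\<^esub>)"

definition no_identical_rows :: "'a mat \<Rightarrow> bool" where
  "no_identical_rows D \<longleftrightarrow>
     (\<forall>i<dim_row D. \<forall>j<dim_row D. i \<noteq> j \<longrightarrow> row D i \<noteq> row D j)"

text \<open>Block \<open>(i, j)\<close> of the Kronecker sum, of the same shape as \<open>Y\<close>, is \<open>X $$ (i, j)\<close> added to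
  every entry of \<open>Y\<close>.\<close>

definition kronecker_sum :: "('a, 'b) ring_scheme \<Rightarrow> 'a mat \<Rightarrow> 'a mat \<Rightarrow> 'a mat" where
  "kronecker_sum A X Y =
     mat (dim_row X * dim_row Y) (dim_col X * dim_col Y)
       (\<lambda>(i, j). X $$ (i div dim_row Y, j div dim_col Y) \<oplus>\<^bsub>A\<^esub>
                 Y $$ (i mod dim_row Y, j mod dim_col Y))"

end

(* Index rows of the Kronecker sum by pairs (a, s) and columns by pairs (b, t), so that the entry is
   F(a,b) + D(t,s). Two rows with equal s agree wherever rows of F do, giving lam * (r * q); with
   s, s' distinct, each b contributes the r indices t at which D(t,s') - D(t,s) takes a prescribed
   value. Counting the coincidences of a single row of F with all rows gives
   m + (n - 1) * lam = m * n / q, which excludes m = lam * q. If a level permutation p carries column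
   (b, t) to (b', t'), the zero column s = 0 shows that p carries column b of F to column b', so
   b = b'; as all levels occur in that column, p is the identity and rows t, t' of D coincide. *)
theory Submission imports Defs begin

section \<open>Counting by fibres and by pairs of indices\<close>

lemma card_equal_fibres:
  assumes "finite S" "finite C" "f ` S \<subseteq> C" "y \<in> C"
    and "\<And>x. x \<in> C \<Longrightarrow> card {s \<in> S. f s = x} = card {s \<in> S. f s = y}"
  shows "card C * card {s \<in> S. f s = y} = card S"
proof -
  have "card S = (\<Sum>x\<in>C. card {s \<in> S. f s = x})"
    using sum.group[OF assms(1-3), of "\<lambda>_. 1::nat"] by simp
  also have "\<dots> = (\<Sum>x\<in>C. card {s \<in> S. f s = y})"
    using assms(5) by (intro sum.cong) auto
  finally show ?thesis by simp
qed

text \<open>Passing from \<open>k\<close> to \<open>(k div N, k mod N)\<close> turns a count over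
  the rows (\<open>N = c\<close>) or columns (\<open>N = r * q\<close>) of a Kronecker sum into a
  count over pairs block, position in the block. For \<open>N = 0\<close> both sides vanish.\<close>

lemma card_div_mod:
  fixes M N :: nat
  shows "card {k. k < M * N \<and> P (k div N) (k mod N)} = (\<Sum>b<M. card {t. t < N \<and> P b t})"
proof -
  let ?f = "\<lambda>(b, t). b * N + t" and ?S = "Sigma {..<M} (\<lambda>b. {t. t < N \<and> P b t})"
  have mem: "k < M * N \<and> P (k div N) (k mod N) \<longleftrightarrow> k \<in> ?f ` ?S" for k
  proof
    assume k: "k < M * N \<and> P (k div N) (k mod N)"
    then have "N > 0" by (cases N) auto
    then have "(k div N, k mod N) \<in> ?S"
      using k by (auto simp: less_mult_imp_div_less)
    then show "k \<in> ?f ` ?S" by (rule rev_image_eqI) simp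
  next
    assume "k \<in> ?f ` ?S"
    then obtain b t where bt: "b < M" "t < N" "P b t" "k = b * N + t" by auto
    have "Suc b * N \<le> M * N" using bt(1) by (intro mult_right_mono) auto
    then show "k < M * N \<and> P (k div N) (k mod N)" using bt by auto
  qed
  have "inj_on ?f ?S"
  proof (rule inj_onI, clarsimp)
    fix b t b' t' assume t: "t < N" "t' < N" and e: "b * N + t = b' * N + t'"
    have "(b * N + t) div N = b" "(b' * N + t') div N = b'" using t by auto
    then have "b = b'" by (metis e)
    then show "b = b' \<and> t = t'" using e by simp
  qed
  moreover have "{k. k < M * N \<and> P (k div N) (k mod N)} = ?f ` ?S"
    using mem by blast
  ultimately have "card {k. k < M * N \<and> P (k div N) (k mod N)} = card ?S"
    by (simp add: card_image)
  also have "\<dots> = (\<Sum>b<M. card {t. t < N \<and> P b t})"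
    by (simp add: card_SigmaI)
  finally show ?thesis .
qed

text \<open>Double counting of the pairs satisfying \<open>P\<close>, used to choose which of the
  two indices is held fixed.\<close>

lemma sum_card_swap:
  fixes M N :: nat
  shows "(\<Sum>b<M. card {t. t < N \<and> P b t}) = (\<Sum>t<N. card {b. b < M \<and> P b t})"
proof -
  have e: "card {t. t < K \<and> Q t} = (\<Sum>t<K. if Q t then 1 else 0)" for K :: nat and Q
    by (simp add: sum.If_cases Int_def lessThan_def)
  show ?thesis unfolding e by (rule sum.swap)
qed

section \<open>Exact frequencies in balanced designs and difference matrices\<close>

lemma balanced_designD:
  assumes "balanced_design n q m F"
  shows "0 < n" "0 < m" "F \<in> carrier_mat n m"
    and "i < n \<Longrightarrow> j < m \<Longrightarrow> F $$ (i, j) < q"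
    and "j < m \<Longrightarrow> a < q \<Longrightarrow> b < q \<Longrightarrow>
      card {i. i < n \<and> F $$ (i, j) = a} = card {i. i < n \<and> F $$ (i, j) = b}"
  using assms unfolding balanced_design_def atLeast0LessThan Ball_def lessThan_iff by blast+

lemma difference_matrixD:
  assumes "difference_matrix A r c q D"
  shows "abelian_group A" "finite (carrier A)" "card (carrier A) = q" "0 < r" "0 < c"
    "D \<in> carrier_mat (r * q) c"
    and "i < r * q \<Longrightarrow> j < c \<Longrightarrow> D $$ (i, j) \<in> carrier A"
    and "j < c \<Longrightarrow> k < c \<Longrightarrow> j \<noteq> k \<Longrightarrow> x \<in> carrier A \<Longrightarrow> y \<in> carrier A \<Longrightarrow>
      card {i. i < r * q \<and> D $$ (i, j) \<ominus>\<^bsub>A\<^esub> D $$ (i, k) = x} =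
      card {i. i < r * q \<and> D $$ (i, j) \<ominus>\<^bsub>A\<^esub> D $$ (i, k) = y}"
  using assms unfolding difference_matrix_def by blast+

text \<open>The \<open>q\<close> levels share the \<open>n\<close> rows equally. The product form
  avoids a division.\<close>

lemma balanced_design_count:
  assumes "balanced_design n q m F" "j < m" "a < q"
  shows "q * card {i. i < n \<and> F $$ (i, j) = a} = n"
proof -
  have "card {0..<q} * card {i \<in> {..<n}. F $$ (i, j) = a} = card {..<n}"
  proof (rule card_equal_fibres)
    show "card {s \<in> {..<n}. F $$ (s, j) = x} = card {s \<in> {..<n}. F $$ (s, j) = a}"
      if "x \<in> {0..<q}" for x
      using balanced_designD(5)[OF assms(1,2), of x a] assms(3) that by simp
  qed (use assms(3) balanced_designD(4)[OF assms(1) _ assms(2)] in auto)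
  then show ?thesis by simp
qed

lemma balanced_design_level_occurs:
  assumes "balanced_design n q m F" "j < m" "a < q"
  obtains i where "i < n" "F $$ (i, j) = a"
proof -
  have "card {i. i < n \<and> F $$ (i, j) = a} \<noteq> 0"
    using balanced_design_count[OF assms] balanced_designD(1)[OF assms(1)]
    by (metis mult_0_right less_irrefl)
  then have "{i. i < n \<and> F $$ (i, j) = a} \<noteq> {}" by (metis card.empty)
  then show ?thesis using that by blast
qed

text \<open>The \<open>r * q\<close> rows are shared equally by the \<open>q\<close> possible
  differences, and \<open>q > 0\<close> can be cancelled because \<open>x\<close> witnesses that the
  group is nonempty.\<close>

lemma difference_matrix_count:
  assumes "difference_matrix A r c q D" "j < c" "k < c" "j \<noteq> k" "x \<in> carrier A"
  shows "card {i. i < r * q \<and> D $$ (i, j) \<ominus>\<^bsub>A\<^esub> D $$ (i, k) = x} = r"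
proof -
  interpret abelian_group A by (rule difference_matrixD(1)[OF assms(1)])
  have "card (carrier A) * card {i \<in> {..<r * q}. D $$ (i, j) \<ominus>\<^bsub>A\<^esub> D $$ (i, k) = x}
      = card {..<r * q}"
  proof (rule card_equal_fibres)
    show "card {i \<in> {..<r * q}. D $$ (i, j) \<ominus>\<^bsub>A\<^esub> D $$ (i, k) = y} =
      card {i \<in> {..<r * q}. D $$ (i, j) \<ominus>\<^bsub>A\<^esub> D $$ (i, k) = x}" if "y \<in> carrier A" for y
      using difference_matrixD(8)[OF assms(1-4) that assms(5)] by simp
  qed (use assms(2,3,5) difference_matrixD(2,7)[OF assms(1)] in auto)
  moreover have "card (carrier A) = q" "q > 0"
    using assms(5) difference_matrixD(2,3)[OF assms(1)] by (auto simp: card_gt_0_iff)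
  ultimately show ?thesis by simp
qed

lemma constant_coincidence_ne:
  assumes F: "balanced_design n q m F" and q: "q \<ge> 2"
    and lam: "\<And>i j. i < n \<Longrightarrow> j < n \<Longrightarrow> i \<noteq> j \<Longrightarrow> coincidence_number F i j = lam"
  shows "m \<noteq> lam * q"
proof
  assume m: "m = lam * q"
  have n: "n > 0" "m > 0" "dim_col F = m" and lev: "\<And>k. k < m \<Longrightarrow> F $$ (0, k) < q"
    using balanced_designD(1-4)[OF F] by auto
  have "(\<Sum>j<n. coincidence_number F 0 j) = m + (n - 1) * lam"
  proof -
    \<comment> \<open>Row 0 agrees with itself in all \<open>m\<close> columns; each of the other
      \<open>n - 1\<close> rows contributes \<open>lam\<close>.\<close>
    have "(\<Sum>j<n. coincidence_number F 0 j)
        = coincidence_number F 0 0 + (\<Sum>j\<in>{..<n} - {0}. coincidence_number F 0 j)"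
      using n by (intro sum.remove) auto
    also have "(\<Sum>j\<in>{..<n} - {0}. coincidence_number F 0 j) = (\<Sum>j\<in>{..<n} - {0}. lam)"
      using lam n by (intro sum.cong) auto
    finally show ?thesis using n by (simp add: coincidence_number_def)
  qed
  \<comment> \<open>Counted by columns instead: column \<open>k\<close> contributes the number of
    rows with level \<open>F $$ (0, k)\<close>, and \<open>q\<close> times that number is
    \<open>n\<close>.\<close>
  moreover have "q * (\<Sum>j<n. coincidence_number F 0 j) = m * n"
  proof -
    have "(\<Sum>j<n. coincidence_number F 0 j)
        = (\<Sum>k<m. card {j. j < n \<and> F $$ (j, k) = F $$ (0, k)})"
      unfolding coincidence_number_def n(3)
      by (subst sum_card_swap) (simp add: eq_commute)
    also have "q * \<dots> = (\<Sum>k<m. n)"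
      unfolding sum_distrib_left
      using balanced_design_count[OF F] lev by (intro sum.cong) auto
    finally show ?thesis by simp
  qed
  ultimately have "q * (lam * q + (n - 1) * lam) = q * (lam * n)"
    using m by (simp add: algebra_simps)
  then have "lam * q + (n - 1) * lam = lam * n" using q by simp
  \<comment> \<open>Removing the truncated \<open>n - 1\<close> leaves \<open>lam * q = lam\<close>.
    As \<open>q \<ge> 2\<close>, this forces \<open>lam = 0\<close> and hence
    \<open>m = 0\<close>.\<close>
  moreover obtain k where "n = Suc k" using n by (cases n) auto
  ultimately have "lam * q = lam" by (simp add: algebra_simps)
  then show False using q m n by simp
qed

section \<open>Moving terms across equations in an abelian group\<close>

lemma (in abelian_group) add_eq_iff_minus:
  assumes "x \<in> carrier G" "y \<in> carrier G" "z \<in> carrier G"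
  shows "x \<oplus> y = z \<longleftrightarrow> x = z \<ominus> y"
  using assms by (auto simp: a_minus_def add.inv_solve_right)

text \<open>Separates the entries of \<open>D\<close> (\<open>y\<close>, \<open>w\<close>) from
  those of \<open>F\<close> (\<open>x\<close>, \<open>z\<close>), so that a coincidence in the
  Kronecker sum becomes a prescribed difference in \<open>D\<close>.\<close>

lemma (in abelian_group) add_eq_add_iff_minus:
  assumes "x \<in> carrier G" "y \<in> carrier G" "z \<in> carrier G" "w \<in> carrier G"
  shows "x \<oplus> y = z \<oplus> w \<longleftrightarrow> y \<ominus> w = z \<ominus> x"
proof -
  have "x \<oplus> y = z \<oplus> w \<longleftrightarrow> y \<oplus> x = z \<oplus> w"
    using assms by (simp add: a_comm)
  also have "\<dots> \<longleftrightarrow> y = (z \<oplus> w) \<ominus> x"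
    using assms by (simp add: add_eq_iff_minus)
  also have "(z \<oplus> w) \<ominus> x = (z \<ominus> x) \<oplus> w"
    using assms by (simp add: a_minus_def a_ac)
  also have "y = (z \<ominus> x) \<oplus> w \<longleftrightarrow> y \<ominus> w = z \<ominus> x"
    using assms add_eq_iff_minus[of "z \<ominus> x" w y] by auto
  finally show ?thesis .
qed

section \<open>The Kronecker sum of a balanced design and a transposed difference matrix\<close>

context
  fixes A :: "(nat, 'b) ring_scheme" and D F :: "nat mat" and q r c n m :: nat
  assumes car: "carrier A = {0..<q}"
    and D: "difference_matrix A r c q D"
    and F: "balanced_design n q m F"
begin

interpretation abelian_group A
  by (rule difference_matrixD(1)[OF D])

private abbreviation (input) "K \<equiv> kronecker_sum A F (transpose_mat D)"

private lemma entry_D: "t < r * q \<Longrightarrow> s < c \<Longrightarrow> D $$ (t, s) \<in> carrier A"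
  by (rule difference_matrixD(7)[OF D])

private lemma entry_F: "a < n \<Longrightarrow> b < m \<Longrightarrow> F $$ (a, b) \<in> carrier A"
  using balanced_designD(4)[OF F] by (simp add: car)

private lemma dims: "dim_row F = n" "dim_col F = m" "dim_row D = r * q" "dim_col D = c"
  "c > 0" "r * q > 0"
  \<comment> \<open>The zero of the group lies in \<open>{0..<q}\<close>, which gives
    \<open>q > 0\<close>.\<close>
  using difference_matrixD(4-6)[OF D] balanced_designD(3)[OF F] zero_closed car by auto

private lemma dim_K: "dim_row K = n * c" "dim_col K = m * (r * q)"
  by (simp_all add: kronecker_sum_def dims)

text \<open>Blocks have the shape of D', that is \<open>c\<close> by \<open>r * q\<close>; the
  transpose makes the column position the first index of \<open>D\<close>.\<close>

private lemma entry_K: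
  assumes "i < n * c" "j < m * (r * q)"
  shows "K $$ (i, j) = F $$ (i div c, j div (r * q)) \<oplus>\<^bsub>A\<^esub> D $$ (j mod (r * q), i mod c)"
  using assms dims by (simp add: kronecker_sum_def)

private lemma index_bounds:
  "i < n * c \<Longrightarrow> i div c < n" "i mod c < c"
  "j < m * (r * q) \<Longrightarrow> j div (r * q) < m" "j mod (r * q) < r * q"
  using dims(5,6) by (simp_all add: less_mult_imp_div_less)

text \<open>For fixed \<open>s\<close>, the rows \<open>(a, s)\<close> of column
  \<open>(b, t)\<close> form column \<open>b\<close> of \<open>F\<close> translated by
  \<open>D $$ (t, s)\<close>. Translation permutes the group, so every level occurs n/q times among
  them, and there are \<open>c\<close> choices of \<open>s\<close>.\<close>

lemma balanced_design_kronecker_sum: "balanced_design (c * n) q (r * q * m) K"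
proof -
  have count: "q * card {i. i < n * c \<and> K $$ (i, j) = x} = n * c"
    if j: "j < m * (r * q)" and x: "x < q" for j x
  proof -
    let ?b = "j div (r * q)" and ?t = "j mod (r * q)"
    note bt = index_bounds(3)[OF j] index_bounds(4)[of j]
    have "{i. i < n * c \<and> K $$ (i, j) = x}
        = {i. i < n * c \<and> F $$ (i div c, ?b) \<oplus>\<^bsub>A\<^esub> D $$ (?t, i mod c) = x}"
      using entry_K[OF _ j] by auto
    then have "card {i. i < n * c \<and> K $$ (i, j) = x}
        = (\<Sum>a<n. card {s. s < c \<and> F $$ (a, ?b) \<oplus>\<^bsub>A\<^esub> D $$ (?t, s) = x})"
      by (simp only: card_div_mod[where P = "\<lambda>a s. F $$ (a, ?b) \<oplus>\<^bsub>A\<^esub> D $$ (?t, s) = x"])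
    also have "\<dots> = (\<Sum>s<c. card {a. a < n \<and> F $$ (a, ?b) \<oplus>\<^bsub>A\<^esub> D $$ (?t, s) = x})"
      by (rule sum_card_swap)
    also have "\<dots> = (\<Sum>s<c. card {a. a < n \<and> F $$ (a, ?b) = x \<ominus>\<^bsub>A\<^esub> D $$ (?t, s)})"
      using bt x entry_D entry_F car
      by (intro sum.cong refl arg_cong[where f = card] Collect_cong conj_cong add_eq_iff_minus) auto
    also have "q * \<dots> = (\<Sum>s<c. n)"
      unfolding sum_distrib_left
    proof (rule sum.cong)
      fix s assume "s \<in> {..<c}"
      then have "x \<ominus>\<^bsub>A\<^esub> D $$ (?t, s) \<in> carrier A"
        using bt x entry_D car by (intro minus_closed) auto
      then show "q * card {a. a < n \<and> F $$ (a, ?b) = x \<ominus>\<^bsub>A\<^esub> D $$ (?t, s)} = n"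
        using balanced_design_count[OF F bt(1)] car by simp
    qed simp
    finally show ?thesis by simp
  qed
  have "K $$ (i, j) \<in> {0..<q}" if "i < n * c" "j < m * (r * q)" for i j
    using entry_K[OF that] index_bounds that entry_D entry_F unfolding car[symmetric]
    by (simp add: a_closed)
  moreover have "card {i. i < n * c \<and> K $$ (i, j) = x} = card {i. i < n * c \<and> K $$ (i, j) = y}"
    if "j < m * (r * q)" "x < q" "y < q" for j x y
  proof -
    have "q * card {i. i < n * c \<and> K $$ (i, j) = x} = q * card {i. i < n * c \<and> K $$ (i, j) = y}"
      using count that by simp
    then show ?thesis using that by simp
  qed
  moreover have "0 < n" "0 < m" using balanced_designD(1,2)[OF F] by auto
  then have "0 < n * c" "0 < m * (r * q)" using dims(5,6) by (metis nat_0_less_mult_iff)+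
  moreover have "K \<in> carrier_mat (n * c) (m * (r * q))" using dim_K by (rule carrier_matI)
  ultimately have "balanced_design (n * c) q (m * (r * q)) K"
    unfolding balanced_design_def
    by (intro conjI allI ballI impI) (assumption | simp only: atLeastLessThan_iff | blast)+
  then show ?thesis by (simp only: mult.commute)
qed

lemma coincidence_number_kronecker_sum:
  assumes i: "i < n * c" and j: "j < n * c"
  shows "coincidence_number K i j =
    (if i mod c = j mod c then coincidence_number F (i div c) (j div c) * (r * q) else m * r)"
proof -
  let ?a = "i div c" and ?s = "i mod c" and ?a' = "j div c" and ?s' = "j mod c"
  let ?P = "\<lambda>b t. F $$ (?a, b) \<oplus>\<^bsub>A\<^esub> D $$ (t, ?s) = F $$ (?a', b) \<oplus>\<^bsub>A\<^esub> D $$ (t, ?s')"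
  note bds = index_bounds(1)[OF i] index_bounds(1)[OF j] index_bounds(2)[of i] index_bounds(2)[of j]
  have "{k. k < dim_col K \<and> K $$ (i, k) = K $$ (j, k)}
      = {k. k < m * (r * q) \<and> ?P (k div (r * q)) (k mod (r * q))}"
    using entry_K[OF i] entry_K[OF j] by (auto simp: dim_K)
  then have sum: "coincidence_number K i j = (\<Sum>b<m. card {t. t < r * q \<and> ?P b t})"
    unfolding coincidence_number_def by (simp only: card_div_mod[where P = ?P])
  show ?thesis
  proof (cases "?s = ?s'")
    case True
    \<comment> \<open>With \<open>t\<close> held fixed, both rows add the same entry of
      \<open>D\<close>, which cancels; every \<open>t\<close> contributes the coincidences of two
      rows of \<open>F\<close>.\<close>
    have "(\<Sum>b<m. card {t. t < r * q \<and> ?P b t}) = (\<Sum>t<r * q. card {b. b < m \<and> ?P b t})"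
      by (rule sum_card_swap)
    also have "\<dots> = (\<Sum>t<r * q. coincidence_number F ?a ?a')"
      unfolding coincidence_number_def dims(2)
      using bds entry_D entry_F True
      by (intro sum.cong refl arg_cong[where f = card] Collect_cong conj_cong) auto
    finally show ?thesis using sum True by simp
  next
    case False
    \<comment> \<open>With \<open>b\<close> held fixed, the two entries of \<open>F\<close>
      prescribe one difference between two distinct columns of \<open>D\<close>.\<close>
    have "(\<Sum>b<m. card {t. t < r * q \<and> ?P b t}) = (\<Sum>b<m. r)"
    proof (rule sum.cong)
      fix b assume "b \<in> {..<m}"
      then have Fb: "F $$ (?a, b) \<in> carrier A" "F $$ (?a', b) \<in> carrier A"
        using bds entry_F by auto
      have "card {t. t < r * q \<and> ?P b t}
          = card {t. t < r * q \<and> D $$ (t, ?s) \<ominus>\<^bsub>A\<^esub> D $$ (t, ?s') = F $$ (?a', b) \<ominus>\<^bsub>A\<^esub> F $$ (?a, b)}"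
        using bds entry_D Fb
        by (intro arg_cong[where f = card] Collect_cong conj_cong refl add_eq_add_iff_minus) auto
      also have "\<dots> = r"
        using bds Fb False by (intro difference_matrix_count[OF D]) auto
      finally show "card {t. t < r * q \<and> ?P b t} = r" .
    qed simp
    then show ?thesis using sum False by simp
  qed
qed

lemma coincidence_numbers_kronecker_sum:
  assumes c: "1 < c" and n: "1 < n"
    and lam: "\<And>i j. i < n \<Longrightarrow> j < n \<Longrightarrow> i \<noteq> j \<Longrightarrow> coincidence_number F i j = lam"
  shows "coincidence_numbers K = {m * r, lam * r * q}"
proof
  show "coincidence_numbers K \<subseteq> {m * r, lam * r * q}"
  proof
    fix x assume "x \<in> coincidence_numbers K"
    then obtain i j where ij: "i < n * c" "j < n * c" "i \<noteq> j" and x: "x = coincidence_number K i j"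
      by (auto simp: coincidence_numbers_def dim_K)
    \<comment> \<open>Distinct rows at the same position must lie in different blocks, hence come
      from different rows of \<open>F\<close>.\<close>
    have "i div c \<noteq> j div c" if "i mod c = j mod c"
      using that ij(3) by (metis div_mult_mod_eq)
    then show "x \<in> {m * r, lam * r * q}"
      using coincidence_number_kronecker_sum[OF ij(1,2)] lam index_bounds(1) ij x
      by (auto simp: mult.assoc)
  qed
  have "1 * c < n * c" using c n by (intro mult_strict_right_mono) auto
  then have b: "0 < n * c" "1 < n * c" "c < n * c" using c by linarith+
  \<comment> \<open>Both values are attained: rows 0 and 1 lie in one block at different positions
    since \<open>c > 1\<close>; rows 0 and \<open>c\<close> are the first rows of two blocks since
    \<open>n > 1\<close>.\<close>
  have "coincidence_number K 0 1 = m * r" "coincidence_number K 0 c = lam * r * q"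
    using coincidence_number_kronecker_sum[OF b(1,2)] coincidence_number_kronecker_sum[OF b(1,3)]
      lam[of 0 1] c n by (auto simp: mult.assoc)
  moreover have "coincidence_number K 0 j \<in> coincidence_numbers K" if "j < n * c" "0 \<noteq> j" for j
    unfolding coincidence_numbers_def dim_K using b(1) that by blast
  from this[of 1] this[of c]
  have "coincidence_number K 0 1 \<in> coincidence_numbers K"
    "coincidence_number K 0 c \<in> coincidence_numbers K"
    using b(2,3) c by simp_all
  ultimately show "{m * r, lam * r * q} \<subseteq> coincidence_numbers K" by simp
qed

lemma no_fully_aliased_columns_kronecker_sum:
  assumes zero: "\<And>i. i < r * q \<Longrightarrow> D $$ (i, 0) = \<zero>\<^bsub>A\<^esub>"
    and rows: "no_identical_rows D" and cols: "no_fully_aliased_columns q F"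
  shows "no_fully_aliased_columns q K"
  unfolding no_fully_aliased_columns_def dim_K
proof (intro allI impI notI)
  fix j k assume j: "j < m * (r * q)" and k: "k < m * (r * q)" and "j \<noteq> k"
    and "fully_aliased q (col K j) (col K k)"
  then obtain p where p: "p permutes {0..<q}" "col K k = map_vec p (col K j)"
    by (auto simp: fully_aliased_def)
  let ?b = "j div (r * q)" and ?t = "j mod (r * q)" and ?b' = "k div (r * q)" and ?t' = "k mod (r * q)"
  note bt = index_bounds(3)[OF j] index_bounds(4)[of j] index_bounds(3)[OF k] index_bounds(4)[of k]
  have eq: "F $$ (a, ?b') \<oplus>\<^bsub>A\<^esub> D $$ (?t', s) = p (F $$ (a, ?b) \<oplus>\<^bsub>A\<^esub> D $$ (?t, s))"
    if a: "a < n" and s: "s < c" for a s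
  proof -
    have "Suc a * c \<le> n * c" using a by (intro mult_right_mono) auto
    then have i: "a * c + s < n * c" using s by simp
    have "K $$ (a * c + s, k) = p (K $$ (a * c + s, j))"
      using arg_cong[OF p(2), of "\<lambda>v. v $ (a * c + s)"] i j k by (simp add: dim_K)
    then show ?thesis using entry_K[OF i j] entry_K[OF i k] s by simp
  qed
  \<comment> \<open>At \<open>s = 0\<close> both entries of \<open>D\<close> are the group
    zero.\<close>
  have pF: "F $$ (a, ?b') = p (F $$ (a, ?b))" if "a < n" for a
    using eq[OF that dims(5)] zero bt entry_F that by simp
  have "col F ?b' = map_vec p (col F ?b)"
    using pF bt dims by (intro eq_vecI) auto
  then have "fully_aliased q (col F ?b) (col F ?b')"
    using p(1) by (auto simp: fully_aliased_def)
  then have b: "?b = ?b'"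
    using cols bt dims by (auto simp: no_fully_aliased_columns_def)
  \<comment> \<open>With equal blocks, \<open>pF\<close> says that \<open>p\<close> fixes each entry
    of column \<open>?b\<close>, and by balance these are all the levels.\<close>
  have p_id: "p x = x" if "x \<in> carrier A" for x
    using that balanced_design_level_occurs[OF F bt(1), of x] pF b car by (metis atLeastLessThan_iff)
  have "D $$ (?t', s) = D $$ (?t, s)" if s: "s < c" for s
  proof -
    \<comment> \<open>Any row of \<open>F\<close> will do, since its entry cancels from both
      sides.\<close>
    obtain a where a: "a < n" using balanced_designD(1)[OF F] by blast
    have "F $$ (a, ?b) \<oplus>\<^bsub>A\<^esub> D $$ (?t', s) = F $$ (a, ?b) \<oplus>\<^bsub>A\<^esub> D $$ (?t, s)"
      using eq[OF a s] p_id bt entry_D entry_F a s b by simp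
    then show ?thesis using bt entry_D entry_F a s by simp
  qed
  then have "row D ?t = row D ?t'"
    using bt dims by (intro eq_vecI) auto
  then have "?t = ?t'" using rows bt(2,4) dims(3) unfolding no_identical_rows_def by metis
  then show False using b \<open>j \<noteq> k\<close> by (metis div_mult_mod_eq)
qed

end

theorem theorem2:
  fixes A :: "(nat, 'b) ring_scheme"
    and D F :: "nat mat"
    and q r c n m lam :: nat
  assumes "q \<ge> 2"
    and "carrier A = {0..<q}"
    and "normalized_difference_matrix A r c q D"
    and "no_identical_rows D"
    and "balanced_design n q m F"
    and "no_fully_aliased_columns q F"
    and "\<And>i j. i < n \<Longrightarrow> j < n \<Longrightarrow> i \<noteq> j \<Longrightarrow> coincidence_number F i j = lam"
  shows "balanced_design (c * n) q (r * q * m) (kronecker_sum A F (transpose_mat D)) \<and>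
         coincidence_numbers (kronecker_sum A F (transpose_mat D)) = {m * r, lam * r * q} \<and>
         m * r \<noteq> lam * r * q \<and>
         no_fully_aliased_columns q (kronecker_sum A F (transpose_mat D))"
proof -
  have D: "difference_matrix A r c q D" "1 < c" "\<And>i. i < r * q \<Longrightarrow> D $$ (i, 0) = \<zero>\<^bsub>A\<^esub>"
    using assms(3) by (auto simp: normalized_difference_matrix_def)
  note r = difference_matrixD(4)[OF D(1)] and m = balanced_designD(2,1)[OF assms(5)]
  \<comment> \<open>\<open>n\<close> is a positive multiple of \<open>q \<ge> 2\<close>, so
    \<open>F\<close> has two different rows and the value \<open>lam * r * q\<close> is
    attained.\<close>
  have "q dvd n"
    using balanced_design_count[OF assms(5) m(1), of 0] assms(1)
    by (metis dvd_triv_left gr0I not_numeral_le_zero)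
  then have n: "1 < n" using dvd_imp_le[OF _ m(2)] assms(1) by fastforce
  have "m * r \<noteq> lam * q * r"
    using constant_coincidence_ne[OF assms(5,1,7)] r by simp
  then have "m * r \<noteq> lam * r * q" by (simp add: mult.assoc mult.commute[of q])
  then show ?thesis
    using balanced_design_kronecker_sum[OF assms(2) D(1) assms(5)]
      coincidence_numbers_kronecker_sum[OF assms(2) D(1) assms(5) D(2) n assms(7)]
      no_fully_aliased_columns_kronecker_sum[OF assms(2) D(1) assms(5) D(3) assms(4,6)]
    by blast
qed

end
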